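(* Let $k \geq 2$ be an integer, let $F_n^{(k)}$ denote the $n$-th $k$-generalized Fibonacci number, and let $\alpha_1, \dots, \alpha_k$ be the (complex) roots of $x^k - x^{k-1} - \cdots - x - 1 = 0$. Then for all integers $n \geq 2-k$, $$F_n^{(k)} = \sum_{i=1}^k \frac{\alpha_i - 1}{2 + (k+1)(\alpha_i - 2)}\, \alpha_i^{n-1}.$$
   Context: For an integer $k \geq 2$, the $k$-generalized Fibonacci numbers $F_n^{(k)}$ (for integers $n \geq 2-k$) are defined by the $k$ initial values $F_n^{(k)} = 0$ for $2-k \leq n \leq 0$ and $F_1^{(k)} = 1$, together with the recurrence $F_n^{(k)} = F_{n-1}^{(k)} + F_{n-2}^{(k)} + \cdots + F_{n-k}^{(k)}$ for all $n \geq 2$. *)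

theory Defs
  imports Complex_Main "HOL-Computational_Algebra.Polynomial"
begin

text \<open>
  The sequence is indexed by integers. Only indices \<open>n \<ge> 2 - k\<close> are meaningful; smaller ones
  get the value 0 but are never reached by the recurrence, since \<open>n \<ge> 2\<close> gives \<open>n - k \<ge> 2 - k\<close>.
\<close>

function kfib :: "nat \<Rightarrow> int \<Rightarrow> int" where
  "kfib k n = (if n \<le> 0 then 0 else if n = 1 then 1 else (\<Sum>j = 1..k. kfib k (n - int j)))"
  by pat_completeness auto
termination
  by (relation "measure (\<lambda>(k, n). nat n)") auto

declare kfib.simps [simp del]

lemma kfib_nonpos: "n \<le> 0 \<Longrightarrow> kfib k n = 0"
  by (simp add: kfib.simps)

lemma kfib_1: "kfib k 1 = 1"
  by (simp add: kfib.simps)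

lemma kfib_rec: "n \<ge> 2 \<Longrightarrow> kfib k n = (\<Sum>j = 1..k. kfib k (n - int j))"
  by (subst kfib.simps) simp

definition kfib_poly :: "nat \<Rightarrow> complex poly" where
  "kfib_poly k = monom 1 k - (\<Sum>j<k. monom 1 j)"

end

theory Submission
  imports Defs
begin

text \<open>
  Write \<open>p\<close> for the characteristic polynomial. Since \<open>(x - 1) p(x) = x^(k+1) - 2 x^k + 1\<close>,
  differentiating at a root \<open>\<alpha>\<close> gives \<open>(\<alpha> - 1) p'(\<alpha>) = \<alpha>^(k-1) (2 + (k+1)(\<alpha> - 2))\<close>, so the
  coefficient of \<open>\<alpha>^(n-1)\<close> equals \<open>\<alpha>^(k-1) / p'(\<alpha>)\<close> once the roots are known to be simple. A double
  root would be \<open>2k/(k+1)\<close>, forcing \<open>2 (2k)^k = (k+1)^(k+1)\<close>, which is impossible because \<open>k\<close> and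
  \<open>k + 1\<close> are coprime. The initial values are then Euler's identities
  \<open>\<Sum> \<alpha>^m / p'(\<alpha>) = [m = k - 1]\<close> for \<open>m < k\<close>, obtained by comparing top coefficients in
  Lagrange's interpolation formula, and both sides satisfy the same recurrence.
\<close>

lemma poly_kfib_poly: "poly (kfib_poly k) x = x ^ k - (\<Sum>j<k. x ^ j)"
  by (simp add: kfib_poly_def poly_monom poly_sum)

text \<open>In the product rule only the term differentiating factor \<open>i\<close> survives at
  \<open>\<alpha> i\<close>. The \<open>\<alpha> j\<close> may coincide, so this can later serve to
  prove them distinct.\<close>

lemma poly_pderiv_prod_linear_root:
  fixes \<alpha> :: "'i \<Rightarrow> 'a :: {comm_ring_1, semiring_no_zero_divisors}"
  assumes "finite I" and "i \<in> I"
  shows "poly (pderiv (\<Prod>j\<in>I. [:- \<alpha> j, 1:])) (\<alpha> i) = (\<Prod>j\<in>I - {i}. \<alpha> i - \<alpha> j)"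
  using assms by (subst prod.remove[of I i])
    (simp_all add: pderiv_mult pderiv_pCons poly_prod del: mult_pCons_left)

lemma sum_power_div_prod_diff:
  fixes \<alpha> :: "'i \<Rightarrow> 'a :: field"
  assumes fin: "finite I" and inj: "inj_on \<alpha> I" and m: "m < card I"
  shows "(\<Sum>i\<in>I. \<alpha> i ^ m / (\<Prod>j\<in>I - {i}. \<alpha> i - \<alpha> j)) = (if m = card I - 1 then 1 else 0)"
proof -
  \<comment> \<open>Unnormalised Lagrange basis: each \<open>L i\<close> is monic of degree
    \<open>card I - 1\<close>, so the top coefficient of the interpolant of \<open>x^m\<close> is
    the sum of the \<open>c i\<close>.\<close>
  define L where "L i = (\<Prod>j\<in>I - {i}. [:- \<alpha> j, 1:])" for i
  define c where "c i = \<alpha> i ^ m / (\<Prod>j\<in>I - {i}. \<alpha> i - \<alpha> j)" for i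
  have deg_L: "degree (L i) = card I - 1" if "i \<in> I" for i
    unfolding L_def using that fin by (subst degree_prod_eq_sum_degree) auto
  have coeff_L: "coeff (L i) (card I - 1) = 1" if "i \<in> I" for i
    using lead_coeff_prod[of "\<lambda>j. [:- \<alpha> j, 1:]" "I - {i}"] deg_L[OF that]
    by (simp add: L_def)
  have "(\<Sum>i\<in>I. smult (c i) (L i)) = monom 1 m"
  proof (rule poly_eqI_degree[where A = "\<alpha> ` I"])
    fix x assume "x \<in> \<alpha> ` I"
    then obtain i where i: "i \<in> I" and x: "x = \<alpha> i" by blast
    have "poly (L j) x = 0" if "j \<in> I - {i}" for j
      using that i fin by (auto simp: L_def poly_prod x)
    hence "poly (\<Sum>j\<in>I. smult (c j) (L j)) x = c i * poly (L i) x"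
      using fin i by (subst sum.remove[of I i]) (simp_all add: poly_sum)
    also have "poly (L i) x = (\<Prod>j\<in>I - {i}. \<alpha> i - \<alpha> j)"
      by (simp add: L_def poly_prod x)
    also have "c i * \<dots> = x ^ m"
      using inj i fin by (auto simp: c_def x inj_on_def)
    finally show "poly (\<Sum>j\<in>I. smult (c j) (L j)) x = poly (monom 1 m) x"
      by (simp add: poly_monom)
  next
    have "degree (\<Sum>i\<in>I. smult (c i) (L i)) \<le> card I - 1"
      using fin deg_L by (intro degree_sum_le) (auto intro: order_trans[OF degree_smult_le])
    thus "degree (\<Sum>i\<in>I. smult (c i) (L i)) < card (\<alpha> ` I)"
      using m by (simp add: card_image[OF inj])
    show "degree (monom (1 :: 'a) m) < card (\<alpha> ` I)"
      using m by (simp add: card_image[OF inj] degree_monom_eq)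
  qed
  hence "coeff (\<Sum>i\<in>I. smult (c i) (L i)) (card I - 1) = coeff (monom 1 m) (card I - 1)"
    by simp
  moreover have "coeff (\<Sum>i\<in>I. smult (c i) (L i)) (card I - 1) = (\<Sum>i\<in>I. c i)"
    unfolding coeff_sum by (intro sum.cong refl) (simp only: coeff_smult coeff_L mult_1_right)
  ultimately show ?thesis
    by (auto simp: c_def)
qed

text \<open>The factor \<open>x - 1\<close> telescopes the geometric sum, leaving a trinomial that
  is easy to differentiate.\<close>

lemma kfib_poly_times_linear: "[:-1, 1:] * kfib_poly k = monom 1 (Suc k) - monom 2 k + 1"
proof -
  have "poly ([:-1, 1:] * kfib_poly k) x = poly (monom 1 (Suc k) - monom 2 k + 1) x" for x
  proof -
    have "x ^ k - 1 = (x - 1) * (\<Sum>j<k. x ^ j)"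
      by (rule power_diff_1_eq)
    thus ?thesis
      by (simp add: poly_kfib_poly poly_monom algebra_simps)
  qed
  thus ?thesis
    by (simp add: poly_eq_poly_eq_iff[symmetric] fun_eq_iff)
qed

lemma kfib_poly_root_nonzero:
  assumes "k > 0" and "poly (kfib_poly k) a = 0"
  shows "a \<noteq> 0"
proof
  assume "a = 0"
  moreover have "(\<Sum>j<k. (0 :: complex) ^ j) = 1"
    using assms(1) by (cases k) (simp_all add: sum.lessThan_Suc_shift del: sum.lessThan_Suc)
  ultimately show False
    using assms by (simp add: poly_kfib_poly power_0_left)
qed

lemma kfib_poly_root_pderiv:
  assumes "k > 0" and "poly (kfib_poly k) a = 0"
  shows "(a - 1) * poly (pderiv (kfib_poly k)) a =
    a ^ (k - 1) * (2 + (of_nat k + 1) * (a - 2))"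
proof -
  obtain l where l: "k = Suc l"
    using assms(1) by (cases k) auto
  \<comment> \<open>The other term of the product rule carries the factor
    \<open>poly (kfib_poly k) a = 0\<close>.\<close>
  have "poly (pderiv ([:-1, 1:] * kfib_poly k)) a = (a - 1) * poly (pderiv (kfib_poly k)) a"
    using assms(2) by (simp add: pderiv_mult pderiv_pCons del: mult_pCons_left)
  moreover have "poly (pderiv ([:-1, 1:] * kfib_poly k)) a =
      a ^ (k - 1) * (2 + (of_nat k + 1) * (a - 2))"
    unfolding kfib_poly_times_linear
    by (simp add: pderiv_diff pderiv_add pderiv_monom poly_monom l algebra_simps)
  ultimately show ?thesis by simp
qed

text \<open>\<open>k\<close> divides the left side but is coprime to the right. For
  \<open>k = 1\<close> both sides equal 4.\<close>

lemma two_mult_power_neq: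
  fixes k :: nat
  assumes "k \<ge> 2"
  shows "2 * (2 * k) ^ k \<noteq> (k + 1) ^ (k + 1)"
proof
  assume eq: "2 * (2 * k) ^ k = (k + 1) ^ (k + 1)"
  have "k dvd 2 * (2 * k) ^ k"
    using assms by (intro dvd_mult dvd_power_le[of k _ 1, simplified]) auto
  hence "k dvd (k + 1) ^ (k + 1)"
    using eq by simp
  moreover have "coprime k ((k + 1) ^ (k + 1))"
    by (rule coprime_power_right_iff[THEN iffD2]) simp
  ultimately have "k = 1"
    using coprime_absorb_left by auto
  thus False using assms by simp
qed

lemma kfib_poly_root_denominator:
  assumes k: "k \<ge> 2" and root: "poly (kfib_poly k) a = 0"
  shows "2 + (of_nat k + 1) * (a - 2) \<noteq> 0"
proof
  assume "2 + (of_nat k + 1) * (a - 2) = 0"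
  hence a: "(of_nat k + 1) * a = 2 * of_nat k"
    by (simp add: algebra_simps)
  have "poly ([:-1, 1:] * kfib_poly k) a = 0"
    using root by simp
  hence eq: "a ^ k * (2 - a) = 1"
    unfolding kfib_poly_times_linear by (simp add: poly_monom algebra_simps)
  \<comment> \<open>Clearing denominators in \<open>a ^ k * (2 - a) = 1\<close> for
    \<open>a = 2k/(k+1)\<close>; the second factor becomes \<open>2(k+1) - 2k = 2\<close>.\<close>
  have "((of_nat k + 1) * a) ^ k * (2 * (of_nat k + 1) - (of_nat k + 1) * a) =
      (of_nat k + 1) ^ (k + 1) * (a ^ k * (2 - a))"
    unfolding power_mult_distrib power_add power_one_right right_diff_distrib
    by (simp only: mult_ac)
  hence "of_nat (2 * (2 * k) ^ k) = (of_nat ((k + 1) ^ (k + 1)) :: complex)"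
    unfolding a eq by (simp add: algebra_simps)
  hence "2 * (2 * k) ^ k = (k + 1) ^ (k + 1)"
    by (simp only: of_nat_eq_iff)
  with two_mult_power_neq[OF k] show False by blast
qed

text \<open>This is the root equation multiplied by \<open>a powi (n - k)\<close>, which is
  legitimate for negative exponents because \<open>a\<close> is nonzero.\<close>

lemma kfib_poly_root_powi:
  assumes "k > 0" and root: "poly (kfib_poly k) a = 0"
  shows "a powi n = (\<Sum>j = 1..k. a powi (n - int j))"
proof -
  have a: "a \<noteq> 0"
    using assms by (rule kfib_poly_root_nonzero)
  have "(\<Sum>j = 1..k. a powi (n - int j)) = (\<Sum>j<k. a powi (n - int k) * a ^ j)"
  proof (rule sum.reindex_bij_witness[where i = "\<lambda>j. k - j" and j = "\<lambda>j. k - j"])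
    fix j assume "j \<in> {1..k}"
    thus "a powi (n - int k) * a ^ (k - j) = a powi (n - int j)"
      using a by (simp add: power_int_add[symmetric] of_nat_diff
          flip: power_int_of_nat)
  qed auto
  also have "\<dots> = a powi (n - int k) * a ^ k"
    using root by (simp add: poly_kfib_poly sum_distrib_left)
  also have "\<dots> = a powi n"
    using a by (simp add: power_int_add[symmetric] flip: power_int_of_nat)
  finally show ?thesis ..
qed

theorem theorem1:
  fixes k :: nat and \<alpha> :: "nat \<Rightarrow> complex" and n :: int
  assumes "k \<ge> 2"
    and "kfib_poly k = (\<Prod>i = 1..k. [:- \<alpha> i, 1:])"
    and "n \<ge> 2 - int k"
  shows "of_int (kfib k n) =
    (\<Sum>i = 1..k. (\<alpha> i - 1) / (2 + (of_nat k + 1) * (\<alpha> i - 2)) * \<alpha> i powi (n - 1))"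
proof -
  define D where "D i = (\<Prod>j\<in>{1..k} - {i}. \<alpha> i - \<alpha> j)" for i
  define c where "c i = (\<alpha> i - 1) / (2 + (of_nat k + 1) * (\<alpha> i - 2))" for i
  have k: "k > 0"
    using assms(1) by simp
  have root: "poly (kfib_poly k) (\<alpha> i) = 0" if "i \<in> {1..k}" for i
    unfolding assms(2) using that by (auto simp: poly_prod)
  have nz: "\<alpha> i \<noteq> 0" if "i \<in> {1..k}" for i
    using kfib_poly_root_nonzero[OF k root[OF that]] .
  have D: "(\<alpha> i - 1) * D i = \<alpha> i ^ (k - 1) * (2 + (of_nat k + 1) * (\<alpha> i - 2))"
    if "i \<in> {1..k}" for i
    using kfib_poly_root_pderiv[OF k root[OF that]] poly_pderiv_prod_linear_root[of "{1..k}" i \<alpha>] that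
    by (simp add: D_def assms(2))
  have denom: "2 + (of_nat k + 1) * (\<alpha> i - 2) \<noteq> 0" if "i \<in> {1..k}" for i
    using kfib_poly_root_denominator[OF assms(1) root[OF that]] .
  have D_nz: "D i \<noteq> 0" if "i \<in> {1..k}" for i
    using D[OF that] denom[OF that] nz[OF that] by auto
  have c: "c i = \<alpha> i ^ (k - 1) / D i" if "i \<in> {1..k}" for i
    using D[OF that] denom[OF that] D_nz[OF that] by (simp add: c_def field_simps)
  \<comment> \<open>\<open>D i\<close> is the derivative at \<open>\<alpha> i\<close>, and a
    repeated root would put a zero factor into it.\<close>
  have inj: "inj_on \<alpha> {1..k}"
  proof (rule inj_onI, rule ccontr)
    fix i j assume "i \<in> {1..k}" "j \<in> {1..k}" "\<alpha> i = \<alpha> j" "i \<noteq> j"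
    hence "D i = 0"
      by (auto simp: D_def)
    with D_nz[OF \<open>i \<in> {1..k}\<close>] show False by blast
  qed
  have initial: "of_int (kfib k n) = (\<Sum>i = 1..k. c i * \<alpha> i powi (n - 1))"
    if "n \<ge> 2 - int k" "n \<le> 1" for n
  proof -
    \<comment> \<open>The exponents \<open>k - 1\<close> from \<open>c i\<close> and
      \<open>n - 1\<close> add up to \<open>m\<close>, which maps the window from
      \<open>2 - k\<close> to \<open>1\<close> onto \<open>0\<close> to \<open>k - 1\<close>;
      \<open>n = 1\<close> corresponds to \<open>m = k - 1\<close>.\<close>
    define m where "m = nat (n + int k - 2)"
    have "(\<Sum>i = 1..k. c i * \<alpha> i powi (n - 1)) = (\<Sum>i = 1..k. \<alpha> i ^ m / D i)"
    proof (rule sum.cong[OF refl])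
      fix i assume i: "i \<in> {1..k}"
      have "\<alpha> i ^ (k - 1) * \<alpha> i powi (n - 1) = \<alpha> i powi (int (k - 1) + (n - 1))"
        using nz[OF i] by (simp add: power_int_add)
      also have "int (k - 1) + (n - 1) = int m"
        using that k by (simp add: m_def of_nat_diff)
      finally show "c i * \<alpha> i powi (n - 1) = \<alpha> i ^ m / D i"
        by (simp add: c[OF i])
    qed
    also have "\<dots> = (if m = k - 1 then 1 else 0)"
      using sum_power_div_prod_diff[OF _ inj, of m] that k by (simp add: D_def m_def)
    also have "\<dots> = of_int (kfib k n)"
    proof (cases "n = 1")
      case True
      thus ?thesis using k by (simp add: kfib_1 m_def nat_diff_distrib)
    next
      case False
      hence "m \<noteq> k - 1" and "n \<le> 0"
        using that k by (auto simp: m_def)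
      thus ?thesis by (simp add: kfib_nonpos)
    qed
    finally show ?thesis ..
  qed
  have "of_int (kfib k n) = (\<Sum>i = 1..k. c i * \<alpha> i powi (n - 1))"
    using assms(3)
  \<comment> \<open>\<open>nat\<close> collapses all indices \<open>n \<le> 0\<close>, harmlessly:
    the hypothesis is invoked only for \<open>n \<ge> 2\<close>, where \<open>n - j\<close> is
    smaller under \<open>nat\<close> and stays at least \<open>2 - k\<close>.\<close>
  proof (induction "nat n" arbitrary: n rule: less_induct)
    case less
    show ?case
    proof (cases "n \<le> 1")
      case True
      with less.prems show ?thesis by (rule initial)
    next
      case False
      have "of_int (kfib k n) = (\<Sum>j = 1..k. of_int (kfib k (n - int j)) :: complex)"
        using False by (simp add: kfib_rec)
      also have "\<dots> = (\<Sum>j = 1..k. \<Sum>i = 1..k. c i * \<alpha> i powi (n - int j - 1))"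
        using False by (intro sum.cong refl less.hyps) auto
      also have "\<dots> = (\<Sum>i = 1..k. c i * (\<Sum>j = 1..k. \<alpha> i powi (n - 1 - int j)))"
        by (subst sum.swap) (simp add: sum_distrib_left algebra_simps)
      also have "\<dots> = (\<Sum>i = 1..k. c i * \<alpha> i powi (n - 1))"
        using kfib_poly_root_powi[OF k root] by (intro sum.cong refl) simp
      finally show ?thesis .
    qed
  qed
  thus ?thesis
    by (simp add: c_def)
qed

end
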